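(* Let $X\subset\mathbb{R}^N$ be a nonempty convex closed set, let $Q:X\times\mathcal{Z}\to\mathbb{R}_+$ be a loss function such that $Q(\cdot,Z):X\to\mathbb{R}_+$ is almost surely convex on $X$, let $f(x)=\mathbb{E}\,Q(x,Z)$, let $Z_1,Z_2,\dots$ be i.i.d. with the same distribution as $Z$, and let $u_k(x)=\nabla_x Q(x,Z_k)$ be stochastic subgradients with $\mathbb{E}\,u_k(x)\in\partial f(x)$ for all $x\in X$. Suppose that, for some constant $L_{X,Q}\in(0,\infty)$, $$\sup_{x\in X}\mathbb{E}\,\|\nabla_x Q(x,Z)\|_*^2\le L_{X,Q}^2 .$$ Let $V:X\to\mathbb{R}_+$ be a convex function such that for every $\beta>0$ the function $$W_\beta(\zeta)=\sup_{x\in X}\{-\zeta^T x-\beta V(x)\},\qquad \zeta\in\mathbb{R}^N,$$ is continuously differentiable on $\mathbb{R}^N$ and, for a constant $\alpha>0$ independent of $\beta$, $$\|\nabla W_\beta(\zeta)-\nabla W_\beta(\tilde\zeta)\|\le\frac{1}{\alpha\beta}\|\zeta-\tilde\zeta\|_*\qquad\forall\,\zeta,\tilde\zeta\in\mathbb{R}^N,\ \beta>0 .$$ Suppose there exists a minimum point $x^*\in\operatorname{Arg\,min}_{x\in X}f(x)$. Let $\beta_0>0$ be arbitrary and $\beta_i=\beta_0\sqrt{i+1}$ for $i\ge1$. Define $\zeta_0=0$, $x_0=-\nabla W_{\beta_0}(\zeta_0)$ and, for $t\ge1$, $$\zeta_t=\zeta_{t-1}+u_t(x_{t-1}),\qquad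 x_t=x_{t-1}-\frac{1}{t+1}\bigl(x_{t-1}+\nabla W_{\beta_t}(\zeta_t)\bigr).$$ Then for every $t\ge1$, $$\mathbb{E}\,f(x_t)-\min_{x\in X}f(x)\le\left(\beta_0V(x^* )+\frac{L_{X,Q}^2}{\alpha\beta_0}\right)\frac{\sqrt{t+2}}{t+1}.$$
   Context: $\|\cdot\|$ is a norm on the primal space $E=\mathbb{R}^N$ and $\|\cdot\|_*$ is the dual norm on the dual space $E^*=\mathbb{R}^N$, i.e. $\|\zeta\|_*=\max_{\|x\|\le1}\zeta^Tx$. $Z$ is a random variable with values in a measurable space $\mathcal{Z}$ and $\mathbb{E}$ is mathematical expectation. $\nabla_xQ(x,z)$ denotes a fixed choice of subgradient of $Q(\cdot,z)$ at $x\in X$, jointly measurable in $(x,z)$; $Q$ is such that $f(x)=\mathbb{E}\,Q(x,Z)$ is well defined and finite for all $x\in X$. $\partial f(x)$ is the subdifferential at $x\in X$ of $f$ as a convex function on $X$, i.e. the set of $g\in\mathbb{R}^N$ with $f(y)\ge f(x)+g^T(y-x)$ for all $y\in X$. The points $-\nabla W_{\beta_t}(\zeta_t)$ lie in $X$, so every $x_t$ lies in $X$ and the recursion is well defined. *)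

theory Defs
  imports "HOL-Probability.Probability"
begin

text \<open>
  The type class norm on \<^typ>\<open>real ^ 'n\<close> is the Euclidean one; an arbitrary norm on the
  same space is therefore a function satisfying the norm axioms.
\<close>

definition is_norm :: "(real ^ 'n \<Rightarrow> real) \<Rightarrow> bool" where
  "is_norm p \<longleftrightarrow>
     (\<forall>x. 0 \<le> p x) \<and> (\<forall>x. p x = 0 \<longleftrightarrow> x = 0) \<and>
     (\<forall>c x. p (c *\<^sub>R x) = \<bar>c\<bar> * p x) \<and> (\<forall>x y. p (x + y) \<le> p x + p y)"

text \<open>
  If \<^term>\<open>p\<close> is a norm, its unit ball is compact and nonempty, so this supremum is a maximum.
\<close>

definition dual_norm :: "(real ^ 'n \<Rightarrow> real) \<Rightarrow> real ^ 'n \<Rightarrow> real" where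
  "dual_norm p \<zeta> = (SUP x\<in>{x. p x \<le> 1}. \<zeta> \<bullet> x)"

definition subdifferential ::
  "(real ^ 'n) set \<Rightarrow> (real ^ 'n \<Rightarrow> real) \<Rightarrow> real ^ 'n \<Rightarrow> (real ^ 'n) set" where
  "subdifferential X f x = {g. \<forall>y\<in>X. f y \<ge> f x + g \<bullet> (y - x)}"

definition gradient :: "(real ^ 'n \<Rightarrow> real) \<Rightarrow> real ^ 'n \<Rightarrow> real ^ 'n" where
  "gradient F \<zeta> = (THE g. GDERIV F \<zeta> :> g)"

definition continuously_differentiable :: "(real ^ 'n \<Rightarrow> real) \<Rightarrow> bool" where
  "continuously_differentiable F \<longleftrightarrow>
     (\<forall>\<zeta>. \<exists>g. GDERIV F \<zeta> :> g) \<and> continuous_on UNIV (gradient F)"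

text \<open>
  The supremum is a real one, so it is meaningful only for arguments at which the family is
  bounded above.
\<close>

definition W_conj ::
  "(real ^ 'n) set \<Rightarrow> (real ^ 'n \<Rightarrow> real) \<Rightarrow> real \<Rightarrow> real ^ 'n \<Rightarrow> real" where
  "W_conj X V b \<zeta> = (SUP x\<in>X. - (\<zeta> \<bullet> x) - b * V x)"

end

theory Submission
  imports Defs
begin

text \<open>
  With \<open>y\<^sub>t = - \<nabla>W\<^bsub>\<beta>\<^sub>t\<^esub>(\<zeta>\<^sub>t)\<close>, the point \<open>x\<^sub>t\<close> is the mean of \<open>y\<^sub>0, \<dots>, y\<^sub>t\<close>. Since \<open>W\<^sub>\<beta>\<close> decreases
  in \<open>\<beta>\<close> and has a Lipschitz gradient, \<open>W\<^bsub>\<beta>\<^sub>t\<^esub>(\<zeta>\<^sub>t)\<close> is a potential function that bounds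
  \<open>\<Sum>\<^sub>t u\<^bsub>t+1\<^esub> \<bullet> (y\<^sub>t - x\<^sup>*)\<close> along each trajectory. As \<open>(x\<^sub>t, \<zeta>\<^sub>t)\<close> depends only on
  \<open>Z\<^sub>1, \<dots>, Z\<^sub>t\<close>, taking expectations replaces \<open>u\<^bsub>t+1\<^esub>\<close> by a subgradient \<open>g\<close> of \<open>f\<close> at \<open>x\<^sub>t\<close>, and
  convexity gives
  \<open>g \<bullet> (y\<^sub>t - x\<^sup>*) \<ge> (t + 1) (f(x\<^sub>t) - f(x\<^sup>*)) - t (f(x\<^bsub>t-1\<^esub>) - f(x\<^sup>*))\<close>, which telescopes. The bound for
  \<open>x\<^sub>t\<close> is obtained by running the sum up to the index \<open>t\<close>, so that the potential at time \<open>t + 1\<close>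
  appears; hence the factor \<open>\<surd>(t + 2)\<close>.
\<close>

section \<open>Norms and dual norms\<close>

lemma
  assumes "is_norm p"
  shows is_norm_nonneg: "0 \<le> p x"
    and is_norm_eq_0_iff: "p x = 0 \<longleftrightarrow> x = 0"
    and is_norm_scaleR: "p (c *\<^sub>R x) = \<bar>c\<bar> * p x"
    and is_norm_triangle: "p (x + y) \<le> p x + p y"
  using assms by (auto simp: is_norm_def)

text \<open>A norm is a finite convex function, and such functions are continuous on open sets of a
  finite-dimensional space. Both Borel measurability and the attainment of extrema on compact sets
  rest on this.\<close>

lemma continuous_on_is_norm:
  assumes "is_norm p"
  shows "continuous_on UNIV p"
proof -
  have "convex_on UNIV p"
  proof (rule convex_onI)
    fix t :: real and x y assume t: "0 < t" "t < 1"
    show "p ((1 - t) *\<^sub>R x + t *\<^sub>R y) \<le> (1 - t) * p x + t * p y"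
      using is_norm_triangle[OF assms, of "(1 - t) *\<^sub>R x" "t *\<^sub>R y"] t
      by (simp add: is_norm_scaleR[OF assms])
  qed simp
  then show ?thesis
    by (rule convex_on_continuous[OF open_UNIV])
qed

lemma borel_measurable_is_norm:
  assumes "is_norm p"
  shows "p \<in> borel_measurable borel"
  by (rule borel_measurable_continuous_onI[OF continuous_on_is_norm[OF assms]])

text \<open>\<open>p\<close> is continuous and positive on the compact Euclidean unit sphere, so its
  maximum there and the reciprocal of its minimum serve as constants. Later this carries second
  moments from the dual norm to the Euclidean norm and turns the Lipschitz bound into a Euclidean
  growth bound.\<close>

lemma is_norm_equivalent_norm:
  assumes "is_norm p"
  obtains C c where "C > 0" "\<And>x. p x \<le> C * norm x" "c > 0" "\<And>x. norm x \<le> c * p x"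
proof -
  let ?S = "sphere (0 :: real ^ 'n) 1"
  have S: "compact ?S" "?S \<noteq> {}"
    by auto
  have cont: "continuous_on ?S p"
    using continuous_on_is_norm[OF assms] continuous_on_subset by blast
  have scale: "p x = norm x * p (x /\<^sub>R norm x)" for x
    by (cases "x = 0") (auto simp: is_norm_scaleR[OF assms] is_norm_eq_0_iff[OF assms])
  obtain a where a: "a \<in> ?S" "\<And>y. y \<in> ?S \<Longrightarrow> p y \<le> p a"
    using continuous_attains_sup[OF S cont] by blast
  obtain b where b: "b \<in> ?S" "\<And>y. y \<in> ?S \<Longrightarrow> p b \<le> p y"
    using continuous_attains_inf[OF S cont] by blast
  have pos: "p a > 0" "p b > 0"
    using a(1) b(1) is_norm_nonneg[OF assms] is_norm_eq_0_iff[OF assms]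
    by (metis less_le norm_zero zero_neq_one mem_sphere_0)+
  have "p x \<le> p a * norm x" for x
  proof (cases "x = 0")
    case False
    then have "p (x /\<^sub>R norm x) \<le> p a"
      by (intro a(2)) simp
    then show ?thesis
      by (subst scale) (metis mult.commute mult_left_mono norm_ge_zero)
  qed (simp add: is_norm_eq_0_iff[OF assms, THEN iffD2])
  moreover have "norm x \<le> 1 / p b * p x" for x
  proof (cases "x = 0")
    case False
    then have "p b \<le> p (x /\<^sub>R norm x)"
      by (intro b(2)) simp
    then have "norm x * p b \<le> p x"
      by (subst (2) scale) (simp add: mult_left_mono)
    then show ?thesis
      using pos by (simp add: field_simps)
  qed (simp add: is_norm_nonneg[OF assms])
  ultimately show ?thesis
    using that[of "p a" "1 / p b"] pos by simp
qed

text \<open>A real supremum is informative only over a bounded set. The unit ball of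
  \<open>p\<close> is bounded in the Euclidean norm, so Cauchy-Schwarz gives the bound.\<close>

lemma dual_norm_bdd_above:
  assumes "is_norm p"
  shows "bdd_above ((\<lambda>x. \<zeta> \<bullet> x) ` {x. p x \<le> 1})"
proof -
  obtain c where c: "c > 0" "\<And>x. norm x \<le> c * p x"
    using is_norm_equivalent_norm[OF assms] by metis
  have "\<zeta> \<bullet> x \<le> norm \<zeta> * c" if "p x \<le> 1" for x
  proof -
    have "norm x \<le> c"
      using c(2)[of x] mult_left_mono[OF that, of c] c(1) by linarith
    then show ?thesis
      using norm_cauchy_schwarz[of \<zeta> x] mult_left_mono[of "norm x" c "norm \<zeta>"] by simp
  qed
  then show ?thesis
    by (intro bdd_aboveI2[where M = "norm \<zeta> * c"]) auto
qed

text \<open>The Hoelder-type inequality for the pairing of the primal and dual spaces, by rescaling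
  \<open>x\<close> to the unit sphere of \<open>p\<close>.\<close>

lemma inner_le_dual_norm:
  assumes "is_norm p"
  shows "\<zeta> \<bullet> x \<le> dual_norm p \<zeta> * p x"
proof (cases "x = 0")
  case False
  then have pos: "p x > 0"
    using is_norm_nonneg[OF assms, of x] is_norm_eq_0_iff[OF assms, of x] by simp
  then have "p (x /\<^sub>R p x) \<le> 1"
    by (simp add: is_norm_scaleR[OF assms])
  then have "\<zeta> \<bullet> (x /\<^sub>R p x) \<le> dual_norm p \<zeta>"
    unfolding dual_norm_def by (intro cSUP_upper dual_norm_bdd_above[OF assms]) simp
  then show ?thesis
    using pos by (simp add: field_simps)
qed (simp add: is_norm_eq_0_iff[OF assms, THEN iffD2])

lemma is_norm_dual_norm:
  assumes "is_norm p"
  shows "is_norm (dual_norm p)"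
proof -
  have ne: "{x. p x \<le> 1} \<noteq> {}"
    using is_norm_eq_0_iff[OF assms, of 0] by (auto intro!: exI[of _ 0])
  have upper: "\<zeta> \<bullet> x \<le> dual_norm p \<zeta>" if "p x \<le> 1" for \<zeta> x
    unfolding dual_norm_def using that by (intro cSUP_upper dual_norm_bdd_above[OF assms]) simp
  have nonneg: "0 \<le> dual_norm p \<zeta>" for \<zeta>
    using upper[of 0 \<zeta>] is_norm_eq_0_iff[OF assms, of 0] by simp
  have zero: "dual_norm p \<zeta> = 0 \<longleftrightarrow> \<zeta> = 0" for \<zeta>
  proof
    assume "dual_norm p \<zeta> = 0"
    then show "\<zeta> = 0"
      using inner_le_dual_norm[OF assms, of \<zeta> \<zeta>] inner_ge_zero[of \<zeta>] inner_eq_zero_iff[of \<zeta>]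
      by simp
  qed (use ne in \<open>simp add: dual_norm_def\<close>)
  have neg: "p (- x) = p x" for x
    using is_norm_scaleR[OF assms, of "-1" x] by simp
  have le: "dual_norm p (c *\<^sub>R \<zeta>) \<le> \<bar>c\<bar> * dual_norm p \<zeta>" for c \<zeta>
    unfolding dual_norm_def[of p "c *\<^sub>R \<zeta>"]
  proof (rule cSUP_least[OF ne], clarify)
    fix x assume x: "p x \<le> 1"
    have "\<bar>\<zeta> \<bullet> x\<bar> \<le> dual_norm p \<zeta>"
      using upper[of x \<zeta>] upper[of "- x" \<zeta>] x neg by (simp add: abs_le_iff)
    then show "c *\<^sub>R \<zeta> \<bullet> x \<le> \<bar>c\<bar> * dual_norm p \<zeta>"
      using abs_ge_self[of "c * (\<zeta> \<bullet> x)"] mult_left_mono[of _ _ "\<bar>c\<bar>"]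
      by (fastforce simp: abs_mult)
  qed
  have "dual_norm p (c *\<^sub>R \<zeta>) = \<bar>c\<bar> * dual_norm p \<zeta>" for c \<zeta>
  proof (cases "c = 0")
    case True
    then show ?thesis
      using zero[of 0] by simp
  next
    case False
    \<comment> \<open>The reverse inequality is \<open>le\<close> again, applied to the scalar
      \<open>inverse c\<close> and the vector \<open>c *\<^sub>R \<zeta>\<close>.\<close>
    have "dual_norm p \<zeta> \<le> \<bar>inverse c\<bar> * dual_norm p (c *\<^sub>R \<zeta>)"
      using le[of "inverse c" "c *\<^sub>R \<zeta>"] False by simp
    then have "\<bar>c\<bar> * dual_norm p \<zeta> \<le> dual_norm p (c *\<^sub>R \<zeta>)"
      using False by (simp add: field_simps)
    then show ?thesis
      using le[of c \<zeta>] by simp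
  qed
  moreover have "dual_norm p (\<zeta> + \<xi>) \<le> dual_norm p \<zeta> + dual_norm p \<xi>" for \<zeta> \<xi>
    unfolding dual_norm_def[of p "\<zeta> + \<xi>"]
    by (rule cSUP_least[OF ne]) (auto simp: inner_add_left intro!: add_mono upper)
  ultimately show ?thesis
    using nonneg zero by (auto simp: is_norm_def)
qed

section \<open>The conjugate function\<close>

text \<open>The definite description denotes the gradient because a linear functional determines its
  representing vector.\<close>

lemma GDERIV_gradient:
  assumes "continuously_differentiable F"
  shows "GDERIV F \<zeta> :> gradient F \<zeta>"
proof -
  have "g = h" if "GDERIV F \<zeta> :> g" "GDERIV F \<zeta> :> h" for g h
  proof -
    have "(\<lambda>x. x \<bullet> g) = (\<lambda>x. x \<bullet> h)"
      using that has_derivative_unique unfolding gderiv_def by blast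
    then show ?thesis
      by (metis inner_commute inner_left_distrib vector_eq_ldot)
  qed
  then have "\<exists>!g. GDERIV F \<zeta> :> g"
    using assms by (auto simp: continuously_differentiable_def)
  then show ?thesis
    unfolding gradient_def by (rule theI')
qed

lemma DERIV_along_line:
  assumes "continuously_differentiable F"
  shows "((\<lambda>s. F (\<zeta> + s *\<^sub>R h)) has_real_derivative (h \<bullet> gradient F (\<zeta> + s *\<^sub>R h))) (at s)"
proof -
  have 1: "((\<lambda>s. \<zeta> + s *\<^sub>R h) has_derivative (\<lambda>r. r *\<^sub>R h)) (at s)"
    by (auto intro!: derivative_eq_intros)
  have 2: "(F has_derivative (\<lambda>k. k \<bullet> gradient F (\<zeta> + s *\<^sub>R h))) (at (\<zeta> + s *\<^sub>R h))"
    using GDERIV_gradient[OF assms] unfolding gderiv_def by blast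
  show ?thesis
    using has_derivative_compose[OF 1 2]
    by (simp add: has_field_derivative_def mult_commute_abs)
qed

lemma descent_lemma:
  assumes p: "is_norm p" and F: "continuously_differentiable F" and K: "0 \<le> K"
    and lip: "\<And>\<xi> \<xi>'. p (gradient F \<xi> - gradient F \<xi>') \<le> K * dual_norm p (\<xi> - \<xi>')"
  shows "F (\<zeta> + h) \<le> F \<zeta> + h \<bullet> gradient F \<zeta> + K / 2 * (dual_norm p h)\<^sup>2"
proof -
  let ?d = "dual_norm p h"
  \<comment> \<open>\<open>\<psi>\<close> is \<open>F\<close> along the segment minus its linear
    part at \<open>\<zeta>\<close> and minus the quadratic upper bound. The claim is
    \<open>\<psi> 1 \<le> \<psi> 0\<close>, and the Lipschitz condition makes the derivative
    nonpositive.\<close>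
  define \<psi> where
    "\<psi> s = F (\<zeta> + s *\<^sub>R h) - s * (h \<bullet> gradient F \<zeta>) - K / 2 * ?d\<^sup>2 * s\<^sup>2" for s
  have "\<psi> 1 \<le> \<psi> 0"
  proof (rule DERIV_nonpos_imp_nonincreasing[where f = \<psi> and a = 0 and b = 1])
    fix s :: real assume s: "0 \<le> s" "s \<le> 1"
    let ?g = "gradient F (\<zeta> + s *\<^sub>R h) - gradient F \<zeta>"
    have "(\<psi> has_real_derivative
        h \<bullet> gradient F (\<zeta> + s *\<^sub>R h) - h \<bullet> gradient F \<zeta> - K * ?d\<^sup>2 * s) (at s)"
      unfolding \<psi>_def by (auto intro!: derivative_eq_intros DERIV_along_line[OF F] simp: algebra_simps)
    moreover have "h \<bullet> ?g \<le> K * ?d\<^sup>2 * s"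
    proof -
      have "h \<bullet> ?g \<le> ?d * p ?g"
        by (rule inner_le_dual_norm[OF p])
      also have "\<dots> \<le> ?d * (K * dual_norm p (s *\<^sub>R h))"
        using lip[of "\<zeta> + s *\<^sub>R h" \<zeta>] is_norm_nonneg[OF is_norm_dual_norm[OF p]]
        by (intro mult_left_mono) auto
      also have "\<dots> = K * ?d\<^sup>2 * s"
        using s by (simp add: is_norm_scaleR[OF is_norm_dual_norm[OF p]] power2_eq_square)
      finally show ?thesis .
    qed
    ultimately show "\<exists>D. (\<psi> has_real_derivative D) (at s) \<and> D \<le> 0"
      by (auto simp: inner_diff_right)
  qed simp
  then show ?thesis
    by (simp add: \<psi>_def)
qed

lemma W_conj_upper:
  assumes "bdd_above ((\<lambda>y. - (\<zeta> \<bullet> y) - b * V y) ` X)" "y \<in> X"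
  shows "- (\<zeta> \<bullet> y) - b * V y \<le> W_conj X V b \<zeta>"
  unfolding W_conj_def using assms by (intro cSUP_upper)

lemma W_conj_antimono:
  assumes "X \<noteq> {}" "\<And>y. y \<in> X \<Longrightarrow> 0 \<le> V y" "a \<le> b"
    and "bdd_above ((\<lambda>y. - (\<zeta> \<bullet> y) - a * V y) ` X)"
  shows "W_conj X V b \<zeta> \<le> W_conj X V a \<zeta>"
  unfolding W_conj_def[of _ _ b]
proof (rule cSUP_least[OF assms(1)])
  fix y assume "y \<in> X"
  then show "- (\<zeta> \<bullet> y) - b * V y \<le> W_conj X V a \<zeta>"
    using W_conj_upper[OF assms(4)] mult_right_mono[OF assms(3) assms(2)] by force
qed

text \<open>
  A point outside \<^term>\<open>X\<close> is separated from it by a hyperplane; along its normal the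
  conjugate would then grow more slowly than its gradient allows.
\<close>

lemma neg_gradient_W_conj_mem:
  assumes X: "X \<noteq> {}" "convex X" "closed X"
    and bdd: "\<And>\<xi>. bdd_above ((\<lambda>y. - (\<xi> \<bullet> y) - b * V y) ` X)"
    and C1: "continuously_differentiable (W_conj X V b)"
  shows "- gradient (W_conj X V b) \<zeta> \<in> X"
proof (rule ccontr)
  let ?W = "W_conj X V b"
  let ?g = "gradient ?W \<zeta>"
  assume "- ?g \<notin> X"
  then obtain a c where ac: "a \<bullet> (- ?g) < c" "\<And>y. y \<in> X \<Longrightarrow> a \<bullet> y > c"
    using separating_hyperplane_closed_point[OF X(2,3)] by blast
  \<comment> \<open>Moving by \<open>s\<close> along \<open>a\<close> lowers every member of the
    supremum by at least \<open>s * c\<close>, whereas the derivative of \<open>?W\<close> in this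
    direction at \<open>\<zeta>\<close> exceeds \<open>- c\<close>. The two rates contradict each
    other for small positive \<open>s\<close>.\<close>
  have le: "?W (\<zeta> + s *\<^sub>R a) \<le> ?W \<zeta> - s * c" if "s \<ge> 0" for s
    unfolding W_conj_def[of _ _ _ "\<zeta> + s *\<^sub>R a"]
  proof (rule cSUP_least[OF X(1)])
    fix y assume y: "y \<in> X"
    then show "- ((\<zeta> + s *\<^sub>R a) \<bullet> y) - b * V y \<le> ?W \<zeta> - s * c"
      using W_conj_upper[OF bdd y, of \<zeta>] mult_left_mono[OF less_imp_le[OF ac(2)[OF y]] that]
      by (simp add: inner_add_left)
  qed
  define \<psi> where "\<psi> s = ?W (\<zeta> + s *\<^sub>R a) + s * c" for s
  have "(\<psi> has_real_derivative a \<bullet> ?g + c) (at 0)"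
    unfolding \<psi>_def using DERIV_along_line[OF C1, of \<zeta> a 0]
    by (auto intro!: derivative_eq_intros)
  moreover have "a \<bullet> ?g + c > 0"
    using ac(1) by simp
  ultimately obtain d where "d > 0" "\<And>h. 0 < h \<Longrightarrow> h < d \<Longrightarrow> \<psi> 0 < \<psi> (0 + h)"
    using DERIV_pos_inc_right by blast
  then have "\<psi> 0 < \<psi> (d / 2)"
    by (metis add_0 field_sum_of_halves half_gt_zero less_add_same_cancel1)
  then show False
    using le[of "d / 2"] \<open>d > 0\<close> by (simp add: \<psi>_def)
qed

section \<open>The regret bound\<close>

text \<open>The sequence \<open>v\<close> is arbitrary, so the bound applies along each trajectory
  even though the subgradients depend on the earlier iterates.\<close>

lemma dual_averaging_regret:
  fixes v :: "nat \<Rightarrow> real ^ 'n"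
  assumes p: "is_norm p" and X: "X \<noteq> {}" and V: "\<And>y. y \<in> X \<Longrightarrow> 0 \<le> V y"
    and bdd: "\<And>b \<xi>. b > 0 \<Longrightarrow> bdd_above ((\<lambda>y. - (\<xi> \<bullet> y) - b * V y) ` X)"
    and C1: "\<And>b. b > 0 \<Longrightarrow> continuously_differentiable (W_conj X V b)"
    and "\<alpha> > 0"
    and lip: "\<And>b \<xi> \<xi>'. b > 0 \<Longrightarrow>
      p (gradient (W_conj X V b) \<xi> - gradient (W_conj X V b) \<xi>')
        \<le> 1 / (\<alpha> * b) * dual_norm p (\<xi> - \<xi>')"
    and \<beta>: "\<And>t. \<beta> t > 0" "mono \<beta>"
    and \<zeta>: "\<zeta> 0 = 0" "\<And>t. \<zeta> (Suc t) = \<zeta> t + v t"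
    and z: "z \<in> X"
  shows "(\<Sum>t<T. v t \<bullet> (- gradient (W_conj X V (\<beta> t)) (\<zeta> t) - z))
    \<le> \<beta> T * V z + (\<Sum>t<T. (dual_norm p (v t))\<^sup>2 / (2 * \<alpha> * \<beta> t))"
proof -
  let ?W = "\<lambda>t. W_conj X V (\<beta> t)"
  have step: "v t \<bullet> (- gradient (?W t) (\<zeta> t))
      \<le> ?W t (\<zeta> t) - ?W (Suc t) (\<zeta> (Suc t)) + (dual_norm p (v t))\<^sup>2 / (2 * \<alpha> * \<beta> t)" for t
  proof -
    \<comment> \<open>The parameter is changed first, at the new dual point, which only lowers the
      value. The dual point is then moved with the parameter \<open>\<beta> t\<close> kept fixed, so
      the quadratic term carries \<open>\<beta> t\<close> and not
      \<open>\<beta> (Suc t)\<close>.\<close>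
    have "?W (Suc t) (\<zeta> (Suc t)) \<le> ?W t (\<zeta> (Suc t))"
      using X V \<beta>(1) bdd monoD[OF \<beta>(2), of t "Suc t"] by (intro W_conj_antimono) auto
    moreover have "?W t (\<zeta> t + v t) \<le> ?W t (\<zeta> t) + v t \<bullet> gradient (?W t) (\<zeta> t)
        + 1 / (\<alpha> * \<beta> t) / 2 * (dual_norm p (v t))\<^sup>2"
      using \<beta>(1)[of t] \<open>\<alpha> > 0\<close> by (intro descent_lemma[OF p C1] lip) auto
    ultimately show ?thesis
      by (simp add: \<zeta>(2) mult.assoc mult.left_commute)
  qed
  have "(\<Sum>t<T. v t \<bullet> (- gradient (?W t) (\<zeta> t)))
      \<le> ?W 0 0 - ?W T (\<zeta> T) + (\<Sum>t<T. (dual_norm p (v t))\<^sup>2 / (2 * \<alpha> * \<beta> t))"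
  proof (induction T)
    case (Suc T)
    then show ?case
      using step[of T] by simp
  qed (simp add: \<zeta>(1))
  moreover have "?W 0 0 \<le> 0"
    unfolding W_conj_def using V \<beta>(1)[of 0] by (intro cSUP_least[OF X]) simp
  \<comment> \<open>The comparison point enters here: it competes in the supremum that defines the
    final potential.\<close>
  moreover have "- (\<zeta> T \<bullet> z) - \<beta> T * V z \<le> ?W T (\<zeta> T)"
    using W_conj_upper[OF bdd z] \<beta>(1) by blast
  moreover have "\<zeta> T = (\<Sum>t<T. v t)"
    by (induction T) (simp_all add: \<zeta>)
  ultimately show ?thesis
    by (simp add: inner_diff_right sum_subtractf inner_sum_left)
qed

text \<open>
  The identity behind the bound is \<open>y - z = (x - z) + t (x - x')\<close> for
  \<open>x = (t x' + y) / (t + 1)\<close>.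
\<close>

lemma averaging_subgradient_bound:
  assumes g: "g \<in> subdifferential X f x" and "x' \<in> X" "z \<in> X" "0 \<le> t"
    and x: "x = x' - (1 / (t + 1)) *\<^sub>R (x' - y)"
  shows "(t + 1) * (f x - f z) - t * (f x' - f z) \<le> g \<bullet> (y - z)"
proof -
  have "(t + 1) *\<^sub>R x = (t + 1) *\<^sub>R x' - (x' - y)"
    using \<open>0 \<le> t\<close> unfolding x by (simp add: scaleR_diff_right)
  then have y: "y = (t + 1) *\<^sub>R x - t *\<^sub>R x'"
    by (simp add: algebra_simps)
  have "y - z = (x - z) + t *\<^sub>R (x - x')"
    unfolding y by (simp add: algebra_simps)
  moreover have "f z \<ge> f x + g \<bullet> (z - x)" "f x' \<ge> f x + g \<bullet> (x' - x)"
    using assms by (auto simp: subdifferential_def)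
  moreover from this(2) have "t * f x' \<ge> t * (f x + g \<bullet> (x' - x))"
    using \<open>0 \<le> t\<close> by (rule mult_left_mono)
  ultimately show ?thesis
    unfolding \<open>y - z = _\<close> by (simp add: inner_diff_right inner_add_right algebra_simps)
qed

lemma sum_inverse_sqrt_le: "(\<Sum>t<n. 1 / sqrt (real t + 1)) \<le> 2 * sqrt (real n)"
proof (induction n)
  case (Suc n)
  \<comment> \<open>With a and b the two roots, a^2 - b^2 = 1, so the claim is a^2 - b^2 \<le> 2 a^2
    - 2 a b, that is, 2 a b \<le> a^2 + b^2.\<close>
  have "1 \<le> 2 * sqrt (real n + 1) * (sqrt (real n + 1) - sqrt (real n))"
  proof -
    have "2 * (sqrt (real n + 1) * sqrt (real n)) \<le> (sqrt (real n + 1))\<^sup>2 + (sqrt (real n))\<^sup>2"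
      using sum_squares_bound[of "sqrt (real n + 1)" "sqrt (real n)"] by (simp add: mult.assoc)
    then show ?thesis
      by (simp add: algebra_simps)
  qed
  then have "1 / sqrt (real n + 1) \<le> 2 * (sqrt (real n + 1) - sqrt (real n))"
    by (simp add: field_simps)
  then show ?case
    using Suc by (simp add: algebra_simps)
qed simp

section \<open>Measurability and independence\<close>

text \<open>
  On \<^term>\<open>X\<close> such a function is a supremum of affine functions, hence lower semicontinuous; at
  boundary points it need not be continuous.
\<close>

lemma borel_measurable_subdifferentiable:
  assumes "\<And>x. x \<in> X \<Longrightarrow> subdifferential X f x \<noteq> {}"
  shows "f \<in> borel_measurable (restrict_space borel X)"
proof (rule borel_measurableI_greater)
  fix a
  have "\<exists>U. open U \<and> x \<in> U \<and> (\<forall>y\<in>X \<inter> U. f y > a)" if x: "x \<in> X" "f x > a" for x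
  proof -
    obtain g where g: "\<And>y. y \<in> X \<Longrightarrow> f y \<ge> f x + g \<bullet> (y - x)"
      using assms[OF x(1)] by (auto simp: subdifferential_def)
    \<comment> \<open>On this open set the affine minorant of \<open>f\<close> touching at
      \<open>x\<close> already exceeds \<open>a\<close>; it contains \<open>x\<close> because
      \<open>f x > a\<close>.\<close>
    have "open {y. a < f x + g \<bullet> (y - x)}"
      by (intro open_Collect_less continuous_intros)
    then show ?thesis
      using g x(2) by (intro exI[of _ "{y. a < f x + g \<bullet> (y - x)}"]) force
  qed
  then obtain U where U: "\<And>x. x \<in> X \<Longrightarrow> f x > a \<Longrightarrow>
      open (U x) \<and> x \<in> U x \<and> (\<forall>y\<in>X \<inter> U x. f y > a)"
    by metis
  let ?U = "\<Union>x\<in>{x\<in>X. f x > a}. U x"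
  have "{x \<in> space (restrict_space borel X). a < f x} = X \<inter> ?U"
    using U by (auto simp: space_restrict_space)
  moreover have "open ?U"
    using U by auto
  ultimately show "{x \<in> space (restrict_space borel X). a < f x} \<in> sets (restrict_space borel X)"
    by (auto simp: sets_restrict_space)
qed

context prob_space
begin

text \<open>
  \<^const>\<open>indep_var\<close> forces both variables to take values in the same type; for variables of
  different types, independence is expressed by the product form of the joint distribution.
\<close>

lemma indep_var_distr_compose:
  assumes "indep_var A a B b" and [measurable]: "F \<in> measurable A N" "k \<in> measurable B S"
  shows "distr M N (\<lambda>\<omega>. F (a \<omega>)) \<Otimes>\<^sub>M distr M S (\<lambda>\<omega>. k (b \<omega>))
    = distr M (N \<Otimes>\<^sub>M S) (\<lambda>\<omega>. (F (a \<omega>), k (b \<omega>)))"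
proof -
  have [measurable]: "a \<in> measurable M A" "b \<in> measurable M B"
    and eq: "distr M A a \<Otimes>\<^sub>M distr M B b = distr M (A \<Otimes>\<^sub>M B) (\<lambda>\<omega>. (a \<omega>, b \<omega>))"
    using assms(1) by (simp_all add: indep_var_distribution_eq)
  interpret B: prob_space "distr M B b"
    by (rule prob_space_distr) simp
  interpret S: prob_space "distr (distr M B b) S k"
    by (rule B.prob_space_distr) simp
  have "distr M N (\<lambda>\<omega>. F (a \<omega>)) \<Otimes>\<^sub>M distr M S (\<lambda>\<omega>. k (b \<omega>))
      = distr (distr M A a) N F \<Otimes>\<^sub>M distr (distr M B b) S k"
    by (simp add: distr_distr comp_def)
  also have "\<dots> = distr (distr M A a \<Otimes>\<^sub>M distr M B b) (N \<Otimes>\<^sub>M S) (\<lambda>(x, y). (F x, k y))"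
    by (rule pair_measure_distr) (simp_all, unfold_locales)
  also have "\<dots> = distr M (N \<Otimes>\<^sub>M S) (\<lambda>\<omega>. (F (a \<omega>), k (b \<omega>)))"
    unfolding eq by (simp add: distr_distr comp_def)
  finally show ?thesis .
qed

context
  fixes N S s z
  assumes s [measurable]: "s \<in> measurable M N" and z [measurable]: "z \<in> measurable M S"
    and indep: "distr M N s \<Otimes>\<^sub>M distr M S z = distr M (N \<Otimes>\<^sub>M S) (\<lambda>\<omega>. (s \<omega>, z \<omega>))"
begin

text \<open>Tonelli's theorem on the product law: the state \<open>s\<close> is frozen while the
  fresh sample is averaged. This takes the place of conditioning on the past.\<close>

lemma indep_nn_integral:
  assumes [measurable]: "h \<in> borel_measurable (N \<Otimes>\<^sub>M S)"
  shows "(\<integral>\<^sup>+\<omega>. h (s \<omega>, z \<omega>) \<partial>M) = (\<integral>\<^sup>+\<omega>. \<integral>\<^sup>+y. h (s \<omega>, y) \<partial>distr M S z \<partial>M)"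
proof -
  interpret Z: prob_space "distr M S z"
    by (rule prob_space_distr) simp
  have "(\<integral>\<^sup>+\<omega>. h (s \<omega>, z \<omega>) \<partial>M) = (\<integral>\<^sup>+p. h p \<partial>(distr M N s \<Otimes>\<^sub>M distr M S z))"
    unfolding indep by (simp add: nn_integral_distr)
  also have "\<dots> = (\<integral>\<^sup>+x. \<integral>\<^sup>+y. h (x, y) \<partial>distr M S z \<partial>distr M N s)"
    by (rule Z.nn_integral_fst[symmetric]) simp
  also have "\<dots> = (\<integral>\<^sup>+\<omega>. \<integral>\<^sup>+y. h (s \<omega>, y) \<partial>distr M S z \<partial>M)"
    by (intro nn_integral_distr Z.borel_measurable_nn_integral) simp_all
  finally show ?thesis .
qed

text \<open>The Fubini counterpart for signed functions, used to replace a stochastic subgradient by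
  its mean.\<close>

lemma
  fixes h :: "_ \<Rightarrow> real"
  assumes [measurable]: "h \<in> borel_measurable (N \<Otimes>\<^sub>M S)"
    and int: "integrable M (\<lambda>\<omega>. h (s \<omega>, z \<omega>))"
  shows indep_integrable_integral: "integrable M (\<lambda>\<omega>. \<integral>y. h (s \<omega>, y) \<partial>distr M S z)"
    and indep_integral:
      "(\<integral>\<omega>. h (s \<omega>, z \<omega>) \<partial>M) = (\<integral>\<omega>. \<integral>y. h (s \<omega>, y) \<partial>distr M S z \<partial>M)"
proof -
  interpret Z: prob_space "distr M S z"
    by (rule prob_space_distr) simp
  interpret N: prob_space "distr M N s"
    by (rule prob_space_distr) simp
  interpret P: pair_sigma_finite "distr M N s" "distr M S z" ..
  have inth: "integrable (distr M N s \<Otimes>\<^sub>M distr M S z) h"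
    unfolding indep using int by (subst integrable_distr_eq) simp_all
  have meas: "(\<lambda>x. \<integral>y. h (x, y) \<partial>distr M S z) \<in> borel_measurable N"
    by (rule Z.borel_measurable_lebesgue_integral) simp
  show "integrable M (\<lambda>\<omega>. \<integral>y. h (s \<omega>, y) \<partial>distr M S z)"
    using P.integrable_fst'[OF inth] meas by (simp add: integrable_distr_eq)
  have "(\<integral>\<omega>. h (s \<omega>, z \<omega>) \<partial>M) = (\<integral>p. h p \<partial>(distr M N s \<Otimes>\<^sub>M distr M S z))"
    unfolding indep by (simp add: integral_distr)
  also have "\<dots> = (\<integral>x. \<integral>y. h (x, y) \<partial>distr M S z \<partial>distr M N s)"
    by (rule P.integral_fst'[OF inth, symmetric])
  also have "\<dots> = (\<integral>\<omega>. \<integral>y. h (s \<omega>, y) \<partial>distr M S z \<partial>M)"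
    using meas by (simp add: integral_distr)
  finally show "(\<integral>\<omega>. h (s \<omega>, z \<omega>) \<partial>M) = (\<integral>\<omega>. \<integral>y. h (s \<omega>, y) \<partial>distr M S z \<partial>M)" .
qed

end

end

text \<open>From (a + b)^2 \<le> 2 a^2 + 2 b^2. It propagates finite second moments through the
  recursion; \<open>f\<close> and \<open>g\<close> may take values in other spaces than
  \<open>h\<close>, and a zero function fills the second slot when one bound suffices.\<close>

lemma (in finite_measure) square_integrable_bound:
  fixes h :: "'a \<Rightarrow> 'b :: {real_normed_vector, second_countable_topology}"
  assumes "h \<in> borel_measurable M"
    and "integrable M (\<lambda>\<omega>. (norm (f \<omega>))\<^sup>2)" "integrable M (\<lambda>\<omega>. (norm (g \<omega>))\<^sup>2)"
    and "\<And>\<omega>. \<omega> \<in> space M \<Longrightarrow> norm (h \<omega>) \<le> norm (f \<omega>) + norm (g \<omega>)"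
  shows "integrable M (\<lambda>\<omega>. (norm (h \<omega>))\<^sup>2)"
proof (rule Bochner_Integration.integrable_bound)
  show "integrable M (\<lambda>\<omega>. 2 * (norm (f \<omega>))\<^sup>2 + 2 * (norm (g \<omega>))\<^sup>2)"
    using assms(2,3) by simp
  show "AE \<omega> in M. norm ((norm (h \<omega>))\<^sup>2) \<le> norm (2 * (norm (f \<omega>))\<^sup>2 + 2 * (norm (g \<omega>))\<^sup>2)"
  proof (rule AE_I2)
    fix \<omega> assume "\<omega> \<in> space M"
    then have "(norm (h \<omega>))\<^sup>2 \<le> (norm (f \<omega>) + norm (g \<omega>))\<^sup>2"
      using assms(4) by (intro power_mono) auto
    also have "\<dots> \<le> 2 * (norm (f \<omega>))\<^sup>2 + 2 * (norm (g \<omega>))\<^sup>2"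
      using sum_squares_bound[of "norm (f \<omega>)" "norm (g \<omega>)"] by (simp add: power2_sum)
    finally show "norm ((norm (h \<omega>))\<^sup>2) \<le> norm (2 * (norm (f \<omega>))\<^sup>2 + 2 * (norm (g \<omega>))\<^sup>2)"
      by simp
  qed
qed (use assms(1) in simp)

lemma square_integrable_inner:
  fixes f g :: "'a \<Rightarrow> real ^ 'n"
  assumes "f \<in> borel_measurable M" "g \<in> borel_measurable M"
    and "integrable M (\<lambda>\<omega>. (norm (f \<omega>))\<^sup>2)" "integrable M (\<lambda>\<omega>. (norm (g \<omega>))\<^sup>2)"
  shows "integrable M (\<lambda>\<omega>. f \<omega> \<bullet> g \<omega>)"
proof (rule Bochner_Integration.integrable_bound)
  show "integrable M (\<lambda>\<omega>. (norm (f \<omega>))\<^sup>2 + (norm (g \<omega>))\<^sup>2)"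
    using assms(3,4) by simp
  show "AE \<omega> in M. norm (f \<omega> \<bullet> g \<omega>) \<le> norm ((norm (f \<omega>))\<^sup>2 + (norm (g \<omega>))\<^sup>2)"
  proof (rule AE_I2)
    fix \<omega>
    have "2 * (norm (f \<omega>) * norm (g \<omega>)) \<le> (norm (f \<omega>))\<^sup>2 + (norm (g \<omega>))\<^sup>2"
      using sum_squares_bound[of "norm (f \<omega>)" "norm (g \<omega>)"] by (simp add: mult.assoc)
    moreover have "0 \<le> norm (f \<omega>) * norm (g \<omega>)"
      by simp
    ultimately show "norm (f \<omega> \<bullet> g \<omega>) \<le> norm ((norm (f \<omega>))\<^sup>2 + (norm (g \<omega>))\<^sup>2)"
      using Cauchy_Schwarz_ineq2[of "f \<omega>" "g \<omega>"] unfolding real_norm_def by linarith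
  qed
qed (use assms(1,2) in simp)

section \<open>The convergence theorem\<close>

text \<open>The Bochner integral of a non-integrable function is 0. Therefore the second-moment
  bound uses the extended nonnegative integral, and integrability of \<open>f (x t \<omega>)\<close>
  is part of the conclusion. \<open>W_finite\<close> guards the real supremum in
  \<open>W_conj\<close> in the same spirit. That the iterates stay in \<open>X\<close> is derived in
  the proof.\<close>

theorem theorem1:
  fixes nrm :: "real ^ 'n \<Rightarrow> real"
    and X :: "(real ^ 'n) set"
    and M :: "'w measure"
    and S :: "'z measure"
    and Z :: "'w \<Rightarrow> 'z"
    and Zs :: "nat \<Rightarrow> 'w \<Rightarrow> 'z"
    and Q :: "real ^ 'n \<Rightarrow> 'z \<Rightarrow> real"
    and G :: "real ^ 'n \<Rightarrow> 'z \<Rightarrow> real ^ 'n"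
    and f :: "real ^ 'n \<Rightarrow> real"
    and u :: "nat \<Rightarrow> real ^ 'n \<Rightarrow> 'w \<Rightarrow> real ^ 'n"
    and V :: "real ^ 'n \<Rightarrow> real"
    and L \<alpha> :: real
    and \<beta> :: "nat \<Rightarrow> real"
    and xmin :: "real ^ 'n"
    and \<zeta> x :: "nat \<Rightarrow> 'w \<Rightarrow> real ^ 'n"
  assumes nrm: "is_norm nrm"
    and X: "X \<noteq> {}" "convex X" "closed X"
    and M: "prob_space M"
    and Z: "Z \<in> measurable M S"
    and Zs_indep: "prob_space.indep_vars M (\<lambda>_. S) Zs {1..}"
    and Zs_distr: "\<And>k. k \<ge> 1 \<Longrightarrow> distr M S (Zs k) = distr M S Z"
    and Q_nonneg: "\<And>y z. y \<in> X \<Longrightarrow> z \<in> space S \<Longrightarrow> 0 \<le> Q y z"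
    and Q_convex: "AE \<omega> in M. convex_on X (\<lambda>y. Q y (Z \<omega>))"
    and Q_integrable: "\<And>y. y \<in> X \<Longrightarrow> integrable M (\<lambda>\<omega>. Q y (Z \<omega>))"
    and f: "\<And>y. y \<in> X \<Longrightarrow> f y = (\<integral>\<omega>. Q y (Z \<omega>) \<partial>M)"
    and G_measurable:
      "(\<lambda>(y, z). G y z) \<in> borel_measurable (restrict_space borel X \<Otimes>\<^sub>M S)"
    and G_subgradient:
      "AE \<omega> in M. \<forall>y\<in>X. G y (Z \<omega>) \<in> subdifferential X (\<lambda>y'. Q y' (Z \<omega>)) y"
    and u: "\<And>k y \<omega>. k \<ge> 1 \<Longrightarrow> y \<in> X \<Longrightarrow> \<omega> \<in> space M \<Longrightarrow> u k y \<omega> = G y (Zs k \<omega>)"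
    and u_mean:
      "\<And>k y. k \<ge> 1 \<Longrightarrow> y \<in> X \<Longrightarrow> (\<integral>\<omega>. u k y \<omega> \<partial>M) \<in> subdifferential X f y"
    and L: "L > 0"
    and G_bound:
      "(SUP y\<in>X. \<integral>\<^sup>+\<omega>. ennreal ((dual_norm nrm (G y (Z \<omega>)))\<^sup>2) \<partial>M) \<le> ennreal (L\<^sup>2)"
    and V: "convex_on X V" "\<And>y. y \<in> X \<Longrightarrow> 0 \<le> V y"
    and W_finite: "\<And>b \<xi>. b > 0 \<Longrightarrow> bdd_above ((\<lambda>y. - (\<xi> \<bullet> y) - b * V y) ` X)"
    and W_C1: "\<And>b. b > 0 \<Longrightarrow> continuously_differentiable (W_conj X V b)"
    and alpha: "\<alpha> > 0"
    and W_lipschitz: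
      "\<And>b \<xi> \<xi>'. b > 0 \<Longrightarrow>
         nrm (gradient (W_conj X V b) \<xi> - gradient (W_conj X V b) \<xi>')
           \<le> 1 / (\<alpha> * b) * dual_norm nrm (\<xi> - \<xi>')"
    and xmin: "is_arg_min f (\<lambda>y. y \<in> X) xmin"
    and beta_0: "\<beta> 0 > 0"
    and beta: "\<And>i. i \<ge> 1 \<Longrightarrow> \<beta> i = \<beta> 0 * sqrt (real i + 1)"
    and zeta_0: "\<And>\<omega>. \<omega> \<in> space M \<Longrightarrow> \<zeta> 0 \<omega> = 0"
    and x_0: "\<And>\<omega>. \<omega> \<in> space M \<Longrightarrow> x 0 \<omega> = - gradient (W_conj X V (\<beta> 0)) (\<zeta> 0 \<omega>)"
    and zeta_step:
      "\<And>t \<omega>. t \<ge> 1 \<Longrightarrow> \<omega> \<in> space M \<Longrightarrow>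
         \<zeta> t \<omega> = \<zeta> (t - 1) \<omega> + u t (x (t - 1) \<omega>) \<omega>"
    and x_step:
      "\<And>t \<omega>. t \<ge> 1 \<Longrightarrow> \<omega> \<in> space M \<Longrightarrow>
         x t \<omega> = x (t - 1) \<omega>
           - (1 / (real t + 1)) *\<^sub>R (x (t - 1) \<omega> + gradient (W_conj X V (\<beta> t)) (\<zeta> t \<omega>))"
  shows "\<forall>t\<ge>1.
    integrable M (\<lambda>\<omega>. f (x t \<omega>)) \<and>
    (\<integral>\<omega>. f (x t \<omega>) \<partial>M) - (INF y\<in>X. f y)
      \<le> (\<beta> 0 * V xmin + L\<^sup>2 / (\<alpha> * \<beta> 0)) * (sqrt (real t + 2) / (real t + 1))"
proof -
  interpret prob_space M by (rule M)
  let ?dn = "dual_norm nrm"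
  note dn = is_norm_dual_norm[OF nrm]
  let ?D = "distr M S Z"
  define B where "B = restrict_space borel X"
  define W where "W t = W_conj X V (\<beta> t)" for t
  define y where "y t \<omega> = - gradient (W t) (\<zeta> t \<omega>)" for t \<omega>
  define v where "v t \<omega> = u (Suc t) (x t \<omega>) \<omega>" for t \<omega>
  \<comment> \<open>The state of the recursion. Its first component is treated as an element of
    \<open>B\<close>, the Borel space on \<open>X\<close>, because \<open>G\<close> is jointly
    measurable only there.\<close>
  define s where "s t \<omega> = (x t \<omega>, \<zeta> t \<omega>)" for t \<omega>
  define N where "N = B \<Otimes>\<^sub>M (borel :: (real ^ 'n) measure)"
  define g where "g a = (\<integral>z. G a z \<partial>?D)" for a
  have xmin_X: "xmin \<in> X"
    using xmin by (simp add: is_arg_min_def)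
  have f_min: "f xmin \<le> f a" if "a \<in> X" for a
    using xmin that by (auto simp: is_arg_min_def not_less)
  have INF_f: "(INF a\<in>X. f a) = f xmin"
    using xmin_X f_min by (intro cInf_eq_minimum) auto

  \<comment> \<open>Step sizes and feasibility of the iterates\<close>
  have \<beta>: "\<beta> t = \<beta> 0 * sqrt (real t + 1)" for t
    using beta[of t] by (cases t) auto
  have \<beta>_pos: "\<beta> t > 0" for t
    using beta_0 by (subst \<beta>) simp
  have \<beta>_mono: "mono \<beta>"
    using beta_0 by (intro monoI, subst (1 2) \<beta>) simp
  have W_C1': "continuously_differentiable (W t)" for t
    unfolding W_def by (rule W_C1[OF \<beta>_pos])
  have [measurable]: "gradient (W t) \<in> borel_measurable borel" for t
    using W_C1'[of t] unfolding continuously_differentiable_def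
    by (intro borel_measurable_continuous_onI) simp
  \<comment> \<open>The form for every dual argument is needed again when the state is written as a
    function of the samples.\<close>
  have y_X': "- gradient (W t) \<xi> \<in> X" for t \<xi>
    unfolding W_def by (intro neg_gradient_W_conj_mem X W_finite W_C1 \<beta>_pos)
  have y_X: "y t \<omega> \<in> X" for t \<omega>
    unfolding y_def by (rule y_X')
  have dn_meas [measurable]: "?dn \<in> borel_measurable borel"
    by (rule borel_measurable_is_norm[OF dn])

  have \<zeta>_Suc: "\<zeta> (Suc t) \<omega> = \<zeta> t \<omega> + v t \<omega>" if "\<omega> \<in> space M" for t \<omega>
    using zeta_step[of "Suc t" \<omega>] that by (simp add: v_def)
  have x_0': "x 0 \<omega> = y 0 \<omega>" if "\<omega> \<in> space M" for \<omega>
    using x_0[OF that] by (simp add: y_def W_def)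
  have x_Suc: "x (Suc t) \<omega> = x t \<omega> - (1 / (real (Suc t) + 1)) *\<^sub>R (x t \<omega> - y (Suc t) \<omega>)"
    if "\<omega> \<in> space M" for t \<omega>
    using x_step[of "Suc t" \<omega>] that by (simp add: y_def W_def)
  have average_X: "a - (1 / (real (Suc t) + 1)) *\<^sub>R (a - b) \<in> X" if "a \<in> X" "b \<in> X" for a b t
  proof -
    let ?c = "1 / (real (Suc t) + 1)"
    have "(1 - ?c) *\<^sub>R a + ?c *\<^sub>R b \<in> X"
      using that by (intro convexD_alt[OF X(2)]) auto
    also have "(1 - ?c) *\<^sub>R a + ?c *\<^sub>R b = a - ?c *\<^sub>R (a - b)"
      by (simp add: algebra_simps del: of_nat_Suc)
    finally show ?thesis .
  qed
  have x_X: "x t \<omega> \<in> X" if "\<omega> \<in> space M" for t \<omega>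
    using that by (induction t) (simp_all only: x_0' x_Suc y_X average_X)
  have v_G: "v t \<omega> = G (x t \<omega>) (Zs (Suc t) \<omega>)" if "\<omega> \<in> space M" for t \<omega>
    using u[of "Suc t"] that x_X by (simp add: v_def)

  \<comment> \<open>Measurability of samples and subgradients\<close>
  have Zs_meas [measurable]: "Zs (Suc t) \<in> measurable M S" for t
    using Zs_indep by (auto simp: indep_vars_def)
  have [measurable]: "Z \<in> measurable M S"
    by (rule Z)
  have Zs_distr': "distr M S (Zs (Suc t)) = ?D" for t
    by (rule Zs_distr) simp
  have G_meas [measurable]: "(\<lambda>p. G (fst p) (snd p)) \<in> borel_measurable (B \<Otimes>\<^sub>M S)"
    using G_measurable by (simp add: B_def case_prod_beta')
  have space_B: "space B = X"
    by (simp add: B_def space_restrict_space)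
  have G_meas2 [measurable]: "G a \<in> borel_measurable S" if "a \<in> X" for a
    using measurable_compose[OF measurable_Pair1'[of a B S] G_meas] that by (simp add: space_B)
  have id_B [measurable]: "(\<lambda>a. a) \<in> borel_measurable B"
    unfolding B_def by (rule measurable_restrict_space1) simp

  \<comment> \<open>Moments and mean of the subgradient at a fixed point\<close>
  have G_dual: "(\<integral>\<^sup>+z. ennreal ((?dn (G a z))\<^sup>2) \<partial>?D) \<le> ennreal (L\<^sup>2)" if "a \<in> X" for a
  proof -
    have "(\<integral>\<^sup>+z. ennreal ((?dn (G a z))\<^sup>2) \<partial>?D) = (\<integral>\<^sup>+\<omega>. ennreal ((?dn (G a (Z \<omega>)))\<^sup>2) \<partial>M)"
      using that by (simp add: nn_integral_distr)
    also have "\<dots> \<le> ennreal (L\<^sup>2)"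
      by (rule order_trans[OF SUP_upper G_bound]) fact
    finally show ?thesis .
  qed
  obtain cd where cd: "cd > 0" "\<And>a. norm a \<le> cd * ?dn a"
    using is_norm_equivalent_norm[OF dn] by metis
  interpret D: prob_space ?D
    by (rule prob_space_distr) simp
  have G_int: "integrable ?D (G a)" if "a \<in> X" for a
  proof -
    have "integrable ?D (\<lambda>z. (?dn (G a z))\<^sup>2)"
      using that G_dual[OF that]
      by (intro integrableI_nonneg) (auto simp: less_top[symmetric] top_unique)
    then have "integrable ?D (\<lambda>z. (norm (cd * ?dn (G a z)))\<^sup>2)"
      by (simp add: power_mult_distrib)
    then have "integrable ?D (\<lambda>z. (norm (G a z))\<^sup>2)"
    proof (rule D.square_integrable_bound[where g = "\<lambda>_. 0 :: real", rotated])
      show "norm (G a z) \<le> norm (cd * ?dn (G a z)) + norm (0 :: real)" for z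
        using order_trans[OF cd(2) abs_ge_self] by simp
      show "G a \<in> borel_measurable ?D"
        using G_meas2[OF that] by simp
    qed simp
    \<comment> \<open>Under a probability measure a second moment controls the first, by a \<le> 1 +
      a^2.\<close>
    then have "integrable ?D (\<lambda>z. 1 + (norm (G a z))\<^sup>2)"
      by simp
    then show ?thesis
    proof (rule Bochner_Integration.integrable_bound)
      show "AE z in ?D. norm (G a z) \<le> norm (1 + (norm (G a z))\<^sup>2)"
      proof (rule AE_I2)
        fix z
        show "norm (G a z) \<le> norm (1 + (norm (G a z))\<^sup>2)"
          using sum_squares_bound[of 1 "norm (G a z)"] norm_ge_zero[of "G a z"]
          unfolding real_norm_def one_power2 by linarith
      qed
    qed (use that in simp)
  qed
  have g_subdiff: "g a \<in> subdifferential X f a" if "a \<in> X" for a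
  proof -
    \<comment> \<open>All samples have the law of \<open>Z\<close>, so the mean at the single index
      1 identifies \<open>g a\<close>.\<close>
    have "(\<integral>\<omega>. u 1 a \<omega> \<partial>M) = (\<integral>\<omega>. G a (Zs (Suc 0) \<omega>) \<partial>M)"
      using that u[of 1 a] by (intro Bochner_Integration.integral_cong) auto
    also have "\<dots> = (\<integral>z. G a z \<partial>distr M S (Zs (Suc 0)))"
      using that by (simp add: integral_distr)
    finally show ?thesis
      using u_mean[of 1 a] that by (simp add: Zs_distr' g_def)
  qed
  have f_meas [measurable]: "f \<in> borel_measurable B"
    unfolding B_def using g_subdiff by (intro borel_measurable_subdifferentiable) auto

  \<comment> \<open>The state as a function of past samples, and its independence of the next
    one\<close>
  have factor: "\<exists>F \<in> measurable (PiM {1..t} (\<lambda>_. S)) N.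
      \<forall>\<omega>\<in>space M. s t \<omega> = F (restrict (\<lambda>i. Zs i \<omega>) {1..t})" for t
  proof (induction t)
    case 0
    have "(\<lambda>_. (- gradient (W 0) 0, 0)) \<in> measurable (PiM {1..0} (\<lambda>_. S)) N"
      unfolding N_def using y_X' by (intro measurable_const) (simp add: space_pair_measure space_B)
    then show ?case
      by (rule bexI[rotated]) (auto simp: s_def x_0' y_def zeta_0)
  next
    case (Suc t)
    then obtain F where F: "F \<in> measurable (PiM {1..t} (\<lambda>_. S)) N"
        "\<And>\<omega>. \<omega> \<in> space M \<Longrightarrow> s t \<omega> = F (restrict (\<lambda>i. Zs i \<omega>) {1..t})"
      by blast
    let ?P = "PiM {1..Suc t} (\<lambda>_. S)"
    \<comment> \<open>The map for \<open>t\<close> reads only the first \<open>t\<close> coordinates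
      of the longer sample vector; coordinate \<open>Suc t\<close> supplies the new
      subgradient.\<close>
    have F': "(\<lambda>z. F (restrict z {1..t})) \<in> measurable ?P N"
      by (rule measurable_compose[OF measurable_restrict_subset F(1)]) auto
    define a where "a z = fst (F (restrict z {1..t}))" for z
    define \<xi> where "\<xi> z = snd (F (restrict z {1..t})) + G (a z) (z (Suc t))" for z
    define a' where
      "a' z = a z - (1 / (real (Suc t) + 1)) *\<^sub>R (a z - (- gradient (W (Suc t)) (\<xi> z)))" for z
    have a_meas: "a \<in> measurable ?P B"
      using measurable_compose[OF F'[unfolded N_def] measurable_fst] by (simp add: a_def[abs_def])
    then have a_borel [measurable]: "a \<in> borel_measurable ?P"
      using measurable_compose[OF _ id_B] by simp
    have 1: "(\<lambda>z. snd (F (restrict z {1..t}))) \<in> borel_measurable ?P"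
      using measurable_compose[OF F'[unfolded N_def] measurable_snd] by simp
    have "(\<lambda>z. (a z, z (Suc t))) \<in> measurable ?P (B \<Otimes>\<^sub>M S)"
      by (rule measurable_Pair[OF a_meas measurable_component_singleton]) simp
    from measurable_compose[OF this G_meas] have "(\<lambda>z. G (a z) (z (Suc t))) \<in> borel_measurable ?P"
      by simp
    with 1 have \<xi>_meas [measurable]: "\<xi> \<in> borel_measurable ?P"
      unfolding \<xi>_def[abs_def] by (rule borel_measurable_add)
    have a'_meas: "a' \<in> measurable ?P B"
      unfolding B_def
    proof (rule measurable_restrict_space2)
      show "a' \<in> space ?P \<rightarrow> X"
        unfolding a'_def using measurable_space[OF a_meas]
        by (intro funcsetI average_X y_X') (simp add: space_B)
      show "a' \<in> borel_measurable ?P"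
        unfolding a'_def by measurable
    qed
    have "(\<lambda>z. (a' z, \<xi> z)) \<in> measurable ?P N"
      unfolding N_def by (rule measurable_Pair[OF a'_meas \<xi>_meas])
    moreover have "s (Suc t) \<omega> = (a' (restrict (\<lambda>i. Zs i \<omega>) {1..Suc t}),
        \<xi> (restrict (\<lambda>i. Zs i \<omega>) {1..Suc t}))" if \<omega>: "\<omega> \<in> space M" for \<omega>
    proof -
      let ?z = "restrict (\<lambda>i. Zs i \<omega>) {1..Suc t}"
      have "restrict ?z {1..t} = restrict (\<lambda>i. Zs i \<omega>) {1..t}"
        by (auto simp: restrict_def fun_eq_iff)
      then have eq: "a ?z = x t \<omega>" "snd (F (restrict ?z {1..t})) = \<zeta> t \<omega>"
        using F(2)[OF \<omega>] by (metis a_def s_def fst_conv, metis s_def snd_conv)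
      then have "\<xi> ?z = \<zeta> (Suc t) \<omega>"
        by (simp add: \<xi>_def \<zeta>_Suc[OF \<omega>] v_G[OF \<omega>])
      then show ?thesis
        using eq by (simp add: s_def a'_def x_Suc[OF \<omega>] y_def)
    qed
    ultimately show ?case
      by (intro bexI[where x = "\<lambda>z. (a' z, \<xi> z)"] ballI)
  qed
  have s_meas: "s t \<in> measurable M N"
    and indep: "distr M N (s t) \<Otimes>\<^sub>M distr M S (Zs (Suc t))
      = distr M (N \<Otimes>\<^sub>M S) (\<lambda>\<omega>. (s t \<omega>, Zs (Suc t) \<omega>))" for t
  proof -
    obtain F where F: "F \<in> measurable (PiM {1..t} (\<lambda>_. S)) N"
        "\<And>\<omega>. \<omega> \<in> space M \<Longrightarrow> s t \<omega> = F (restrict (\<lambda>i. Zs i \<omega>) {1..t})"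
      using factor by blast
    let ?past = "\<lambda>\<omega>. restrict (\<lambda>i. Zs i \<omega>) {1..t}"
    let ?next = "\<lambda>\<omega>. restrict (\<lambda>i. Zs i \<omega>) {Suc t}"
    \<comment> \<open>The index blocks are disjoint, hence independent. \<open>F\<close> turns the
      first block into the state, and evaluation at \<open>Suc t\<close> turns the second into the
      next sample.\<close>
    have "indep_var (PiM {1..t} (\<lambda>_. S)) ?past (PiM {Suc t} (\<lambda>_. S)) ?next"
      by (rule indep_var_restrict[OF Zs_indep]) auto
    from indep_var_rv1[OF this] indep_var_distr_compose[OF this F(1), of "\<lambda>z. z (Suc t)" S]
    show "s t \<in> measurable M N"
      and "distr M N (s t) \<Otimes>\<^sub>M distr M S (Zs (Suc t))
        = distr M (N \<Otimes>\<^sub>M S) (\<lambda>\<omega>. (s t \<omega>, Zs (Suc t) \<omega>))"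
      using F by (simp_all add: measurable_component_singleton measurable_compose[OF _ F(1)]
          cong: measurable_cong distr_cong)
  qed
  have x_B [measurable]: "x t \<in> measurable M B" for t
    using measurable_compose[OF s_meas[of t, unfolded N_def] measurable_fst] by (simp add: s_def)
  have x_meas [measurable]: "x t \<in> borel_measurable M" for t
    using measurable_compose[OF x_B id_B] by simp
  have \<zeta>_meas [measurable]: "\<zeta> t \<in> borel_measurable M" for t
    using measurable_compose[OF s_meas[of t, unfolded N_def] measurable_snd] by (simp add: s_def)
  have y_meas [measurable]: "y t \<in> borel_measurable M" for t
    unfolding y_def[abs_def] by measurable
  have fst_N: "fst \<in> measurable N B"
    unfolding N_def by (rule measurable_fst)
  have [measurable]: "snd \<in> borel_measurable N"
    unfolding N_def by (rule measurable_snd)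
  have [measurable]: "fst \<in> borel_measurable N"
    using measurable_compose[OF fst_N id_B] by simp
  have G_state [measurable]: "(\<lambda>p. G (fst (fst p)) (snd p)) \<in> borel_measurable (N \<Otimes>\<^sub>M S)"
  proof -
    have "(\<lambda>p. (fst (fst p), snd p)) \<in> measurable (N \<Otimes>\<^sub>M S) (B \<Otimes>\<^sub>M S)"
      by (intro measurable_Pair measurable_compose[OF measurable_fst fst_N] measurable_snd)
    from measurable_compose[OF this G_meas] show ?thesis
      by simp
  qed
  have v_meas [measurable]: "v t \<in> borel_measurable M" for t
  proof -
    have "(\<lambda>\<omega>. G (x t \<omega>) (Zs (Suc t) \<omega>)) \<in> borel_measurable M"
      using measurable_compose[OF measurable_Pair[OF x_B Zs_meas] G_meas] by simp
    then show ?thesis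
      by (simp cong: measurable_cong add: v_G)
  qed

  \<comment> \<open>Square integrability along the recursion\<close>
  have v_nn: "(\<integral>\<^sup>+\<omega>. ennreal ((?dn (v t \<omega>))\<^sup>2) \<partial>M) \<le> ennreal (L\<^sup>2)" for t
  proof -
    have "(\<integral>\<^sup>+\<omega>. ennreal ((?dn (v t \<omega>))\<^sup>2) \<partial>M)
        = (\<integral>\<^sup>+\<omega>. ennreal ((?dn (G (fst (fst (s t \<omega>, Zs (Suc t) \<omega>))) (snd (s t \<omega>, Zs (Suc t) \<omega>))))\<^sup>2) \<partial>M)"
      by (intro nn_integral_cong) (simp add: v_G s_def)
    \<comment> \<open>With \<open>x t \<omega>\<close> frozen in \<open>X\<close>, the uniform
      moment bound \<open>G_dual\<close> applies to the inner integral.\<close>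
    also have "\<dots> = (\<integral>\<^sup>+\<omega>. \<integral>\<^sup>+z. ennreal ((?dn (G (x t \<omega>) z))\<^sup>2) \<partial>?D \<partial>M)"
      by (subst indep_nn_integral[OF s_meas Zs_meas indep, where h = "\<lambda>p. ennreal ((?dn (G (fst (fst p)) (snd p)))\<^sup>2)"])
        (simp_all add: Zs_distr' s_def)
    also have "\<dots> \<le> (\<integral>\<^sup>+\<omega>. ennreal (L\<^sup>2) \<partial>M)"
      by (intro nn_integral_mono G_dual x_X)
    finally show ?thesis
      by (simp add: emeasure_space_1)
  qed
  have v_dual_int: "integrable M (\<lambda>\<omega>. (?dn (v t \<omega>))\<^sup>2)" for t
    using v_nn[of t] by (intro integrableI_nonneg) (auto simp: less_top[symmetric] top_unique)
  have v_dual_le: "(\<integral>\<omega>. (?dn (v t \<omega>))\<^sup>2 \<partial>M) \<le> L\<^sup>2" for t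
    using v_nn[of t] by (simp add: nn_integral_eq_integral[OF v_dual_int])
  have v_sq: "integrable M (\<lambda>\<omega>. (norm (v t \<omega>))\<^sup>2)" for t
  proof (rule square_integrable_bound[where f = "\<lambda>\<omega>. cd * ?dn (v t \<omega>)" and g = "\<lambda>_. 0 :: real"])
    show "integrable M (\<lambda>\<omega>. (norm (cd * ?dn (v t \<omega>)))\<^sup>2)"
      using v_dual_int by (simp add: power_mult_distrib)
  qed (auto intro: order_trans[OF cd(2) abs_ge_self])
  have \<zeta>_sq: "integrable M (\<lambda>\<omega>. (norm (\<zeta> t \<omega>))\<^sup>2)" for t
  proof (induction t)
    case 0
    then show ?case
      by (simp add: zeta_0 cong: Bochner_Integration.integrable_cong)
  next
    case (Suc t)
    show ?case
      by (rule square_integrable_bound[OF \<zeta>_meas Suc v_sq[of t]])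
        (simp add: \<zeta>_Suc norm_triangle_ineq)
  qed
  obtain Cd where Cd: "Cd > 0" "\<And>a. ?dn a \<le> Cd * norm a"
    using is_norm_equivalent_norm[OF dn] by metis
  obtain c where c: "c > 0" "\<And>a. norm a \<le> c * nrm a"
    using is_norm_equivalent_norm[OF nrm] by metis
  have y_sq: "integrable M (\<lambda>\<omega>. (norm (y t \<omega>))\<^sup>2)" for t
  proof -
    let ?g0 = "gradient (W t) 0"
    let ?K = "1 / (\<alpha> * \<beta> t)"
    have K: "?K > 0"
      using alpha \<beta>_pos by simp
    \<comment> \<open>A Lipschitz gradient grows at most linearly. The constant chains the Lipschitz
      constant \<open>?K\<close> with the norm equivalences \<open>c\<close> and
      \<open>Cd\<close>.\<close>
    have bound: "norm (gradient (W t) \<xi>) \<le> norm ?g0 + norm ((c * (?K * Cd)) *\<^sub>R \<xi>)" for \<xi>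
    proof -
      have "norm (gradient (W t) \<xi> - ?g0) \<le> c * nrm (gradient (W t) \<xi> - ?g0)"
        by (rule c(2))
      also have "\<dots> \<le> c * (?K * ?dn (\<xi> - 0))"
        unfolding W_def using c(1) by (intro mult_left_mono W_lipschitz \<beta>_pos) auto
      also have "\<dots> \<le> c * (?K * (Cd * norm \<xi>))"
        using c(1) K Cd(2)[of \<xi>] by (intro mult_left_mono) auto
      also have "\<dots> = norm ((c * (?K * Cd)) *\<^sub>R \<xi>)"
        using c(1) K Cd(1) by (simp add: abs_mult abs_of_pos[OF alpha] abs_of_pos[OF \<beta>_pos])
      finally show ?thesis
        using norm_triangle_sub[of "gradient (W t) \<xi>" ?g0] by simp
    qed
    show ?thesis
    proof (rule square_integrable_bound[where f = "\<lambda>_. ?g0" and g = "\<lambda>\<omega>. (c * (?K * Cd)) *\<^sub>R \<zeta> t \<omega>"])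
      show "integrable M (\<lambda>\<omega>. (norm ((c * (?K * Cd)) *\<^sub>R \<zeta> t \<omega>))\<^sup>2)"
        unfolding norm_scaleR power_mult_distrib by (intro integrable_mult_right \<zeta>_sq)
      show "norm (y t \<omega>) \<le> norm ?g0 + norm ((c * (?K * Cd)) *\<^sub>R \<zeta> t \<omega>)" for \<omega>
        unfolding y_def norm_minus_cancel by (rule bound)
    qed simp_all
  qed
  have x_sq: "integrable M (\<lambda>\<omega>. (norm (x t \<omega>))\<^sup>2)" for t
  proof (induction t)
    case 0
    then show ?case
      using y_sq[of 0] by (simp add: x_0' cong: Bochner_Integration.integrable_cong)
  next
    case (Suc t)
    show ?case
    proof (rule square_integrable_bound[OF x_meas Suc y_sq[of "Suc t"]])
      fix \<omega> assume \<omega>: "\<omega> \<in> space M"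
      let ?c = "1 / (real (Suc t) + 1)"
      have c: "0 \<le> ?c" "?c \<le> 1"
        by simp_all
      have "x (Suc t) \<omega> = (1 - ?c) *\<^sub>R x t \<omega> + ?c *\<^sub>R y (Suc t) \<omega>"
        unfolding x_Suc[OF \<omega>] by (simp add: algebra_simps del: of_nat_Suc)
      then have "norm (x (Suc t) \<omega>) \<le> (1 - ?c) * norm (x t \<omega>) + ?c * norm (y (Suc t) \<omega>)"
        using norm_triangle_ineq[of "(1 - ?c) *\<^sub>R x t \<omega>" "?c *\<^sub>R y (Suc t) \<omega>"] c
        by (metis abs_of_nonneg diff_ge_0_iff_ge norm_scaleR)
      also have "\<dots> \<le> norm (x t \<omega>) + norm (y (Suc t) \<omega>)"
        using c by (intro add_mono mult_left_le_one_le) auto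
      finally show "norm (x (Suc t) \<omega>) \<le> norm (x t \<omega>) + norm (y (Suc t) \<omega>)" .
    qed
  qed

  \<comment> \<open>Unbiasedness against functions of the state\<close>
  have cross: "integrable M (\<lambda>\<omega>. v t \<omega> \<bullet> w (s t \<omega>))" "integrable M (\<lambda>\<omega>. g (x t \<omega>) \<bullet> w (s t \<omega>))"
      "(\<integral>\<omega>. v t \<omega> \<bullet> w (s t \<omega>) \<partial>M) = (\<integral>\<omega>. g (x t \<omega>) \<bullet> w (s t \<omega>) \<partial>M)"
    if w [measurable]: "w \<in> borel_measurable N" and w_sq: "integrable M (\<lambda>\<omega>. (norm (w (s t \<omega>)))\<^sup>2)"
    for t w
  proof -
    let ?h = "\<lambda>p. G (fst (fst p)) (snd p) \<bullet> w (fst p)"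
    have h: "?h \<in> borel_measurable (N \<Otimes>\<^sub>M S)"
      by measurable
    show vw: "integrable M (\<lambda>\<omega>. v t \<omega> \<bullet> w (s t \<omega>))"
      using measurable_compose[OF s_meas w] by (intro square_integrable_inner v_sq w_sq) simp_all
    have eq: "?h (s t \<omega>, Zs (Suc t) \<omega>) = v t \<omega> \<bullet> w (s t \<omega>)" if "\<omega> \<in> space M" for \<omega>
      using that by (simp add: v_G s_def)
    then have int: "integrable M (\<lambda>\<omega>. ?h (s t \<omega>, Zs (Suc t) \<omega>))"
      using vw by (simp cong: Bochner_Integration.integrable_cong)
    \<comment> \<open>For a fixed state, \<open>w (s t \<omega>)\<close> is a constant vector, so
      integrability of \<open>G (x t \<omega>)\<close> lets the inner product leave the
      integral.\<close>
    have cond: "(\<integral>z. ?h (s t \<omega>, z) \<partial>distr M S (Zs (Suc t))) = g (x t \<omega>) \<bullet> w (s t \<omega>)"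
      if "\<omega> \<in> space M" for \<omega>
      using G_int[OF x_X[OF that]] by (simp add: Zs_distr' s_def g_def)
    show "integrable M (\<lambda>\<omega>. g (x t \<omega>) \<bullet> w (s t \<omega>))"
      by (rule Bochner_Integration.integrable_cong[THEN iffD1, OF refl cond
            indep_integrable_integral[OF s_meas Zs_meas indep h int]])
    have "(\<integral>\<omega>. v t \<omega> \<bullet> w (s t \<omega>) \<partial>M) = (\<integral>\<omega>. ?h (s t \<omega>, Zs (Suc t) \<omega>) \<partial>M)"
      by (intro Bochner_Integration.integral_cong refl eq[symmetric])
    also have "\<dots> = (\<integral>\<omega>. \<integral>z. ?h (s t \<omega>, z) \<partial>distr M S (Zs (Suc t)) \<partial>M)"
      by (rule indep_integral[OF s_meas Zs_meas indep h int])
    also have "\<dots> = (\<integral>\<omega>. g (x t \<omega>) \<bullet> w (s t \<omega>) \<partial>M)"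
      by (intro Bochner_Integration.integral_cong refl cond)
    finally show "(\<integral>\<omega>. v t \<omega> \<bullet> w (s t \<omega>) \<partial>M) = (\<integral>\<omega>. g (x t \<omega>) \<bullet> w (s t \<omega>) \<partial>M)" .
  qed
  have shift_sq: "integrable M (\<lambda>\<omega>. (norm (h \<omega> - xmin))\<^sup>2)"
    if "h \<in> borel_measurable M" "integrable M (\<lambda>\<omega>. (norm (h \<omega>))\<^sup>2)" for h :: "'w \<Rightarrow> real ^ 'n"
  proof (rule square_integrable_bound[where f = h and g = "\<lambda>_. xmin"])
    show "norm (h \<omega> - xmin) \<le> norm (h \<omega>) + norm xmin" for \<omega>
      by (rule norm_triangle_ineq4)
  qed (use that in simp_all)

  have f_int: "integrable M (\<lambda>\<omega>. f (x t \<omega>))" for t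
  proof -
    have "integrable M (\<lambda>\<omega>. g (x t \<omega>) \<bullet> (x t \<omega> - xmin))"
      using cross(2)[of "\<lambda>p. fst p - xmin" t] shift_sq[OF x_meas x_sq] by (simp add: s_def)
    then have "integrable M (\<lambda>\<omega>. \<bar>f xmin\<bar> + g (x t \<omega>) \<bullet> (x t \<omega> - xmin))"
      by simp
    then show ?thesis
    proof (rule Bochner_Integration.integrable_bound)
      show "(\<lambda>\<omega>. f (x t \<omega>)) \<in> borel_measurable M"
        by measurable
      \<comment> \<open>Minimality bounds \<open>f (x t \<omega>)\<close> below by
        \<open>f xmin\<close>, and the subgradient inequality bounds it above by
        \<open>f xmin\<close> plus an inner product already known to be integrable.\<close>
      show "AE \<omega> in M. norm (f (x t \<omega>)) \<le> norm (\<bar>f xmin\<bar> + g (x t \<omega>) \<bullet> (x t \<omega> - xmin))"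
      proof (rule AE_I2)
        fix \<omega> assume "\<omega> \<in> space M"
        note xX = x_X[OF this, of t]
        have "f xmin \<ge> f (x t \<omega>) + g (x t \<omega>) \<bullet> (xmin - x t \<omega>)"
          using g_subdiff[OF xX] xmin_X by (auto simp: subdifferential_def)
        moreover have "g (x t \<omega>) \<bullet> (xmin - x t \<omega>) = - (g (x t \<omega>) \<bullet> (x t \<omega> - xmin))"
          by (simp add: inner_diff_right)
        ultimately show "norm (f (x t \<omega>)) \<le> norm (\<bar>f xmin\<bar> + g (x t \<omega>) \<bullet> (x t \<omega> - xmin))"
          using f_min[OF xX] unfolding real_norm_def by linarith
      qed
    qed
  qed

  \<comment> \<open>Expected excess, telescoping and the final bound\<close>
  define e where "e t = (\<integral>\<omega>. f (x t \<omega>) \<partial>M) - f xmin" for t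
  have vy_int: "integrable M (\<lambda>\<omega>. v t \<omega> \<bullet> (y t \<omega> - xmin))"
    and gy_int: "integrable M (\<lambda>\<omega>. g (x t \<omega>) \<bullet> (y t \<omega> - xmin))"
    and vy_eq: "(\<integral>\<omega>. v t \<omega> \<bullet> (y t \<omega> - xmin) \<partial>M) = (\<integral>\<omega>. g (x t \<omega>) \<bullet> (y t \<omega> - xmin) \<partial>M)" for t
    \<comment> \<open>The point \<open>y t \<omega>\<close> depends on
      \<open>\<zeta> t \<omega>\<close> alone, so its difference from \<open>xmin\<close> is an
      admissible weight on the state.\<close>
    using cross[of "\<lambda>p. - gradient (W t) (snd p) - xmin" t] shift_sq[OF y_meas y_sq, of t]
    by (simp_all add: s_def y_def)
  \<comment> \<open>At \<open>t = 0\<close> the truncated index \<open>t - 1\<close> is again 0. The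
    factor \<open>real t\<close> removes that term, and the averaging step with weight 1 reduces to
    \<open>x 0 \<omega> = y 0 \<omega>\<close>.\<close>
  have progress: "(real t + 1) * e t - real t * e (t - 1) \<le> (\<integral>\<omega>. v t \<omega> \<bullet> (y t \<omega> - xmin) \<partial>M)" for t
  proof -
    have "(real t + 1) * e t - real t * e (t - 1)
        = (\<integral>\<omega>. (real t + 1) * (f (x t \<omega>) - f xmin) - real t * (f (x (t - 1) \<omega>) - f xmin) \<partial>M)"
      by (simp add: f_int e_def prob_space)
    also have "\<dots> \<le> (\<integral>\<omega>. g (x t \<omega>) \<bullet> (y t \<omega> - xmin) \<partial>M)"
    proof (rule integral_mono)
      fix \<omega> assume \<omega>: "\<omega> \<in> space M"
      have "x t \<omega> = x (t - 1) \<omega> - (1 / (real t + 1)) *\<^sub>R (x (t - 1) \<omega> - y t \<omega>)"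
        using x_0'[OF \<omega>] x_Suc[OF \<omega>, of "t - 1"] by (cases t) auto
      then show "(real t + 1) * (f (x t \<omega>) - f xmin) - real t * (f (x (t - 1) \<omega>) - f xmin)
          \<le> g (x t \<omega>) \<bullet> (y t \<omega> - xmin)"
        by (rule averaging_subgradient_bound[OF g_subdiff[OF x_X[OF \<omega>]] x_X[OF \<omega>] xmin_X, rotated]) simp
    qed (simp_all add: f_int gy_int)
    finally show ?thesis
      by (simp add: vy_eq)
  qed
  have telescope: "real T * e (T - 1) \<le> (\<Sum>t<T. \<integral>\<omega>. v t \<omega> \<bullet> (y t \<omega> - xmin) \<partial>M)" for T
  proof (induction T)
    case (Suc T)
    then show ?case
      using progress[of T] by (simp add: add.commute)
  qed simp

  have main: "real T * e (T - 1) \<le> \<beta> T * V xmin + L\<^sup>2 / (\<alpha> * \<beta> 0) * sqrt (real T)" for T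
  proof -
    have "real T * e (T - 1) \<le> (\<integral>\<omega>. (\<Sum>t<T. v t \<omega> \<bullet> (y t \<omega> - xmin)) \<partial>M)"
      using telescope[of T] by (simp add: vy_int)
    also have "\<dots> \<le> (\<integral>\<omega>. \<beta> T * V xmin + (\<Sum>t<T. (?dn (v t \<omega>))\<^sup>2 / (2 * \<alpha> * \<beta> t)) \<partial>M)"
    proof (rule integral_mono)
      fix \<omega> assume \<omega>: "\<omega> \<in> space M"
      show "(\<Sum>t<T. v t \<omega> \<bullet> (y t \<omega> - xmin))
          \<le> \<beta> T * V xmin + (\<Sum>t<T. (?dn (v t \<omega>))\<^sup>2 / (2 * \<alpha> * \<beta> t))"
        unfolding y_def W_def
        using zeta_0[OF \<omega>] \<zeta>_Suc[OF \<omega>] xmin_X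
        by (intro dual_averaging_regret[OF nrm X(1) V(2) W_finite W_C1 alpha W_lipschitz \<beta>_pos \<beta>_mono])
    qed (auto intro!: vy_int v_dual_int Bochner_Integration.integrable_sum Bochner_Integration.integrable_add)
    also have "\<dots> = \<beta> T * V xmin + (\<Sum>t<T. (\<integral>\<omega>. (?dn (v t \<omega>))\<^sup>2 \<partial>M) / (2 * \<alpha> * \<beta> t))"
      by (simp add: v_dual_int prob_space)
    also have "\<dots> \<le> \<beta> T * V xmin + (\<Sum>t<T. L\<^sup>2 / (2 * \<alpha> * \<beta> t))"
      using v_dual_le alpha \<beta>_pos
      by (intro add_left_mono sum_mono divide_right_mono) (auto simp: less_imp_le)
    also have "(\<Sum>t<T. L\<^sup>2 / (2 * \<alpha> * \<beta> t))
        = L\<^sup>2 / (2 * \<alpha> * \<beta> 0) * (\<Sum>t<T. 1 / sqrt (real t + 1))"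
      unfolding sum_distrib_left by (intro sum.cong refl, subst \<beta>) simp
    \<comment> \<open>The 2 from the sum of inverse roots cancels the 2 from the quadratic term of
      the descent inequality.\<close>
    also have "\<dots> \<le> L\<^sup>2 / (2 * \<alpha> * \<beta> 0) * (2 * sqrt (real T))"
      using alpha beta_0 by (intro mult_left_mono sum_inverse_sqrt_le) simp
    finally show ?thesis
      by simp
  qed
  show ?thesis
  proof (intro allI impI conjI f_int)
    fix t :: nat
    have "(real t + 1) * e t \<le> \<beta> (Suc t) * V xmin + L\<^sup>2 / (\<alpha> * \<beta> 0) * sqrt (real t + 1)"
      using main[of "Suc t"] by (simp add: add.commute)
    \<comment> \<open>Since \<open>\<beta> (Suc t)\<close> equals
      \<open>\<beta> 0 * sqrt (real t + 2)\<close>, enlarging the other root to match gives both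
      terms a common factor.\<close>
    also have "\<dots> \<le> \<beta> (Suc t) * V xmin + L\<^sup>2 / (\<alpha> * \<beta> 0) * sqrt (real t + 2)"
      using alpha beta_0 by (intro add_left_mono mult_left_mono) auto
    also have "\<dots> = (\<beta> 0 * V xmin + L\<^sup>2 / (\<alpha> * \<beta> 0)) * sqrt (real t + 2)"
      by (subst \<beta>) (simp add: algebra_simps)
    finally have "e t \<le> (\<beta> 0 * V xmin + L\<^sup>2 / (\<alpha> * \<beta> 0)) * sqrt (real t + 2) / (real t + 1)"
      by (simp add: pos_le_divide_eq mult.commute)
    then show "(\<integral>\<omega>. f (x t \<omega>) \<partial>M) - (INF a\<in>X. f a)
        \<le> (\<beta> 0 * V xmin + L\<^sup>2 / (\<alpha> * \<beta> 0)) * (sqrt (real t + 2) / (real t + 1))"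
      by (simp add: INF_f e_def)
  qed
qed

end
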